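(* Let $j\in\{1,\dots,n\}$, let $D\in\mathcal D_n$, let $\bar z$ be a decision with $L(\bar z,\bar y)<\infty$ for all $(\bar x,\bar y)\in\Omega_n$, and suppose the robustness radius satisfies $r>r^j_n(D)=\inf\{B(D',D):D'\in\mathcal D^j_n\}$. Then the partial bootstrap robust budget $c^j_n(\bar z,D,x_0)$ equals the optimal value of the (dual) convex optimization problem $$\begin{array}{rl}\inf&\alpha\\ \text{s.t.}&\alpha\in\mathbb R,\ \eta=(\eta_1,\eta_2)\in\mathbb R_+^2,\ \nu\in\mathbb R_+,\\ &\nu\log\Big(\sum_{(\bar x,\bar y)\in N^{j-1}_n(x_0)}\exp\big([(L(\bar z,\bar y)-\alpha)\,w_n(\bar x,x_0)+\eta_1-\eta_2]/\nu\big)\,D[\bar x,\bar y]\\ &\qquad+\sum_{(\bar x,\bar y)\in N^j_n(x_0)\setminus N^{j-1}_n(x_0)}\exp\big([(L(\bar z,\bar y)-\alpha)\,w_n(\bar x,x_0)+\eta_1]/\nu\big)\,D[\bar x,\bar y]\\ &\qquad+\sum_{(\bar x,\bar y)\in\Omega_n\setminus N^j_n(x_0)}D[\bar x,\bar y]\Big)+r\,\nu-\frac kn(\eta_1-\eta_2)-\frac{\eta_2}n\le0.\end{array}$$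
   Context: Data. Let $\bar d_1=(\bar x_1,\bar y_1),\dots,\bar d_n=(\bar x_n,\bar y_n)$ be a fixed finite list (training data, $n\ge1$) of points in $\Omega\subseteq\mathbb R^{\dim(x)}\times\mathbb R^{\dim(y)}$, $\Omega_n$ the finite set of distinct points in the list, and $\mathcal D_n$ the set of all probability distributions on $\Omega_n$. Fix a context of interest $x_0\in\mathbb R^{\dim(x)}$. Neighborhoods. $\mathrm{dist}(\bar d,x_0)\ge0$ satisfies $\mathrm{dist}(\bar d,x_0)=\mathrm{dist}(\bar d',x_0)\iff\bar d=\bar d'$. For $j\in\{1,\dots,n\}$ let $R^j_n=\min\{\rho\ge0:\ |\{i\le n:\mathrm{dist}(\bar d_i,x_0)\le\rho\}|\ge j\}$ (counted with multiplicity) and $N^j_n(x_0)=\{\bar d\in\Omega_n:\mathrm{dist}(\bar d,x_0)\le R^j_n\}$; put $N^0_n(x_0)=\emptyset$. $w_n(\bar x,x_0)>0$ is a positive weighing function. $L(z,\bar y)\in\mathbb R_+\cup\{+\infty\}$ is convex in the decision $z\in\mathbb R^{\dim(z)}$ for each $\bar y$ and measurable in $\bar y$ for each $z$. Fix $k\in\{1,\dots,n\}$. $\mathcal D^j_n=\{D\in\mathcal D_n:\ \sum_{N^{j-1}_n(x_0)}D[\bar x,\bar y]\le\frac{k-1}n<\frac kn\le\sum_{N^j_n(x_0)}D[\bar x,\bar y]\}$; $\inf\emptyset=+\infty$. Bootstrap distance. $B(D,D')=\sum_{(\bar x,\bar y)\in\Omega_n}D[\bar x,\bar y]\log\left(D[\bar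 x,\bar y]/D'[\bar x,\bar y]\right)$ (relative entropy, $0\log0=0$, value $+\infty$ if $D\not\ll D'$). Partial bootstrap robust budget. For $r\in\mathbb R_+$, $c^j_n(z,D,x_0)$ is the supremum of $\sum_{N^j_n(x_0)}w_n(\bar x,x_0)L(z,\bar y)P[\bar x,\bar y]$ over $s>0$ and $P:\Omega_n\to[0,\infty)$ subject to $s\,B(P/s,D)\le s\,r$, $\sum_{\Omega_n}P=s$, $\sum_{N^j_n(x_0)}w_n(\bar x,x_0)P[\bar x,\bar y]=1$, $\sum_{N^j_n(x_0)}P\ge s\frac kn$, $\sum_{N^{j-1}_n(x_0)}P\le s\frac{k-1}n$. Convention: at $\nu=0$ the expression $\nu\log(\sum_i\exp(a_i/\nu)D_i)$ is understood as its limit for $\nu\downarrow0$, i.e. $\max\{a_i:D_i>0\}$ (points outside $N^j_n(x_0)$ having $a_i=0$). *)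

theory Defs
  imports "HOL-Probability.Probability"
begin

type_synonym ('dx, 'dy) point = "(real ^ 'dx) \<times> (real ^ 'dy)"

text \<open>The training data are a sequence \<open>d 1, \<dots>, d n\<close>, possibly with repetitions.\<close>

definition support_points :: "nat \<Rightarrow> (nat \<Rightarrow> ('dx, 'dy) point) \<Rightarrow> ('dx, 'dy) point set" where
  "support_points n d = d ` {1..n}"

definition distributions ::
  "nat \<Rightarrow> (nat \<Rightarrow> ('dx::finite, 'dy::finite) point) \<Rightarrow> ('dx, 'dy) point pmf set" where
  "distributions n d = {D. set_pmf D \<subseteq> support_points n d}"

definition nbhd_radius ::
  "nat \<Rightarrow> (nat \<Rightarrow> ('dx::finite, 'dy::finite) point) \<Rightarrow> (('dx, 'dy) point \<Rightarrow> real ^ 'dx \<Rightarrow> real)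
    \<Rightarrow> real ^ 'dx \<Rightarrow> nat \<Rightarrow> real" where
  "nbhd_radius n d dst x0 j = (LEAST \<rho>. 0 \<le> \<rho> \<and> j \<le> card {i \<in> {1..n}. dst (d i) x0 \<le> \<rho>})"

definition nbhd ::
  "nat \<Rightarrow> (nat \<Rightarrow> ('dx::finite, 'dy::finite) point) \<Rightarrow> (('dx, 'dy) point \<Rightarrow> real ^ 'dx \<Rightarrow> real)
    \<Rightarrow> real ^ 'dx \<Rightarrow> nat \<Rightarrow> ('dx, 'dy) point set" where
  "nbhd n d dst x0 j =
     (if j = 0 then {} else {p \<in> support_points n d. dst p x0 \<le> nbhd_radius n d dst x0 j})"

definition partial_distributions ::
  "nat \<Rightarrow> (nat \<Rightarrow> ('dx::finite, 'dy::finite) point) \<Rightarrow> (('dx, 'dy) point \<Rightarrow> real ^ 'dx \<Rightarrow> real)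
    \<Rightarrow> real ^ 'dx \<Rightarrow> nat \<Rightarrow> nat \<Rightarrow> ('dx, 'dy) point pmf set" where
  "partial_distributions n d dst x0 k j =
     {D \<in> distributions n d.
        (\<Sum>p\<in>nbhd n d dst x0 (j - 1). pmf D p) \<le> (real k - 1) / real n \<and>
        (real k - 1) / real n < real k / real n \<and>
        real k / real n \<le> (\<Sum>p\<in>nbhd n d dst x0 j. pmf D p)}"

text \<open>
  The bootstrap distance takes mass functions rather than \<open>pmf\<close>s, since it is also applied to
  a rescaled measure \<open>P / s\<close>. The convention \<open>0 log 0 = 0\<close> holds as \<open>0 * _ = 0\<close>.
\<close>

definition bootstrap_dist :: "'p set \<Rightarrow> ('p \<Rightarrow> real) \<Rightarrow> ('p \<Rightarrow> real) \<Rightarrow> ereal" where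
  "bootstrap_dist S D D' =
     (if \<forall>p\<in>S. D' p = 0 \<longrightarrow> D p = 0 then ereal (\<Sum>p\<in>S. D p * ln (D p / D' p)) else \<infinity>)"

definition min_radius ::
  "nat \<Rightarrow> (nat \<Rightarrow> ('dx::finite, 'dy::finite) point) \<Rightarrow> (('dx, 'dy) point \<Rightarrow> real ^ 'dx \<Rightarrow> real)
    \<Rightarrow> real ^ 'dx \<Rightarrow> nat \<Rightarrow> nat \<Rightarrow> ('dx, 'dy) point pmf \<Rightarrow> ereal" where
  "min_radius n d dst x0 k j D =
     (INF D'\<in>partial_distributions n d dst x0 k j.
        bootstrap_dist (support_points n d) (pmf D') (pmf D))"

definition partial_budget ::
  "nat \<Rightarrow> (nat \<Rightarrow> ('dx::finite, 'dy::finite) point) \<Rightarrow> (('dx, 'dy) point \<Rightarrow> real ^ 'dx \<Rightarrow> real)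
    \<Rightarrow> (real ^ 'dx \<Rightarrow> real ^ 'dx \<Rightarrow> real) \<Rightarrow> (real ^ 'dz \<Rightarrow> real ^ 'dy \<Rightarrow> ereal)
    \<Rightarrow> nat \<Rightarrow> real \<Rightarrow> nat \<Rightarrow> real ^ 'dz \<Rightarrow> ('dx, 'dy) point pmf \<Rightarrow> real ^ 'dx \<Rightarrow> ereal" where
  "partial_budget n d dst w L k r j z D x0 =
     Sup {(\<Sum>(x, y)\<in>nbhd n d dst x0 j. ereal (w x x0) * L z y * ereal (P (x, y))) | s P.
        0 < s \<and>
        (\<forall>p\<in>support_points n d. 0 \<le> P p) \<and>
        ereal s * bootstrap_dist (support_points n d) (\<lambda>p. P p / s) (pmf D) \<le> ereal (s * r) \<and>
        (\<Sum>p\<in>support_points n d. P p) = s \<and>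
        (\<Sum>(x, y)\<in>nbhd n d dst x0 j. w x x0 * P (x, y)) = 1 \<and>
        (\<Sum>p\<in>nbhd n d dst x0 j. P p) \<ge> s * (real k / real n) \<and>
        (\<Sum>p\<in>nbhd n d dst x0 (j - 1). P p) \<le> s * ((real k - 1) / real n)}"

text \<open>
  The first summand of the dual constraint: \<open>N'\<close> and \<open>N\<close> are the inner and outer
  neighborhoods and \<open>a (x, y) = (L z y - \<alpha>) * w x x0\<close>. At \<open>\<nu> = 0\<close> it is the limit
  for \<open>\<nu>\<close> decreasing to \<open>0\<close>, that is, the largest exponent numerator on the support of \<open>D\<close>.
\<close>

definition dual_log_term ::
  "'p set \<Rightarrow> 'p set \<Rightarrow> 'p set \<Rightarrow> ('p \<Rightarrow> real) \<Rightarrow> ('p \<Rightarrow> real) \<Rightarrow> real \<Rightarrow> real \<Rightarrow> real \<Rightarrow> real" where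
  "dual_log_term S N N' D a \<eta>1 \<eta>2 \<nu> =
     (if \<nu> = 0 then
        Max ((\<lambda>p. if p \<in> N' then a p + \<eta>1 - \<eta>2 else if p \<in> N then a p + \<eta>1 else 0)
               ` {p \<in> S. 0 < D p})
      else
        \<nu> * ln ((\<Sum>p\<in>N'. exp ((a p + \<eta>1 - \<eta>2) / \<nu>) * D p)
              + (\<Sum>p\<in>N - N'. exp ((a p + \<eta>1) / \<nu>) * D p)
              + (\<Sum>p\<in>S - N. D p)))"

definition dual_value ::
  "nat \<Rightarrow> (nat \<Rightarrow> ('dx::finite, 'dy::finite) point) \<Rightarrow> (('dx, 'dy) point \<Rightarrow> real ^ 'dx \<Rightarrow> real)
    \<Rightarrow> (real ^ 'dx \<Rightarrow> real ^ 'dx \<Rightarrow> real) \<Rightarrow> (real ^ 'dz \<Rightarrow> real ^ 'dy \<Rightarrow> ereal)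
    \<Rightarrow> nat \<Rightarrow> real \<Rightarrow> nat \<Rightarrow> real ^ 'dz \<Rightarrow> ('dx, 'dy) point pmf \<Rightarrow> real ^ 'dx \<Rightarrow> ereal" where
  "dual_value n d dst w L k r j z D x0 =
     Inf {ereal \<alpha> | \<alpha> \<eta>1 \<eta>2 \<nu>. 0 \<le> \<eta>1 \<and> 0 \<le> \<eta>2 \<and> 0 \<le> \<nu> \<and>
        dual_log_term (support_points n d) (nbhd n d dst x0 j) (nbhd n d dst x0 (j - 1)) (pmf D)
          (\<lambda>(x, y). (real_of_ereal (L z y) - \<alpha>) * w x x0) \<eta>1 \<eta>2 \<nu>
        + r * \<nu> - real k / real n * (\<eta>1 - \<eta>2) - \<eta>2 / real n \<le> 0}"

definition ereal_convex :: "('a::real_vector \<Rightarrow> ereal) \<Rightarrow> bool" where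
  "ereal_convex f \<longleftrightarrow> (\<forall>u v. \<forall>t\<in>{0..1}.
     f ((1 - t) *\<^sub>R u + t *\<^sub>R v) \<le> ereal (1 - t) * f u + ereal t * f v)"

end

theory Submission
  imports Defs "HOL-Real_Asymp.Real_Asymp"
begin

text \<open>
  The budget is a fractional linear program over a relative entropy ball. Dividing \<open>P\<close> by its mass
  \<open>s\<close> turns it into a probability \<open>Q\<close>: the budget is the supremum of the weighted average
  \<open>(\<Sum>N. w L Q) / (\<Sum>N. w Q)\<close> over all \<open>Q\<close> that are supported where \<open>D\<close> is positive, have entropy
  at most \<open>r\<close>, give \<open>N\<close> mass at least \<open>k / n\<close> and give \<open>N'\<close> mass at most \<open>(k - 1) / n\<close>. Hence a
  real \<open>\<alpha>\<close> lies above the budget iff \<open>\<Sum>N. (L - \<alpha>) w Q \<le> 0\<close> for all such \<open>Q\<close>, which is a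
  statement about a concave program on a simplex. The left side of the dual constraint is the
  Lagrangian dual function of that program: the supremum over \<open>Q\<close> of a linear function minus
  \<open>\<nu>\<close> times the entropy is, by Gibbs' variational principle (\<open>soft_max_upper\<close>,
  \<open>soft_max_attained\<close>), \<open>\<nu>\<close> times the logarithm of a sum of exponentials, with the maximum as its value at
  \<open>\<nu> = 0\<close>. Weak duality (\<open>scaled_weak_duality\<close>) is immediate from this.

  For the converse, multipliers are produced for every \<open>\<alpha>\<close> strictly above the budget
  (\<open>entropy_multipliers\<close>, \<open>multipliers_above_budget\<close>), and \<open>\<alpha>\<close> is then let tend to the budget. At the
  budget itself multipliers need not exist: for \<open>k = 1\<close> no \<open>Q\<close> satisfies the bound on \<open>N'\<close>
  strictly, so Slater's condition fails and \<open>\<eta>\<^sub>2\<close> may have to tend to infinity. The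
  argument therefore rests on compactness. The four values (objective and three constraint slacks)
  depend continuously and concavely on \<open>Q\<close> in the compact simplex, so the vectors dominated by
  such values form a closed convex set. For \<open>\<alpha>\<close> strictly above the budget this set misses the
  origin, and a strictly separating hyperplane supplies the multipliers
  (\<open>concave_like_alternative\<close>). The objective gets a positive multiplier, and can be normalised
  to \<open>1\<close>, because a feasible \<open>Q\<close> exists; this is what \<open>r > r\<^sub>j\<close> guarantees.
\<close>

section \<open>A theorem of the alternative for compact concave-like systems\<close>

text \<open>
  The vectors dominated by some \<open>f P\<close> form the sum of the compact set \<open>f ` C\<close> and the closed cone of
  nonpositive vectors, hence a closed set, and the hypothesis on mixtures makes it convex. It misses
  \<open>0\<close>, so a hyperplane separates it strictly from \<open>0\<close>. Asking for mixtures only at the level of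
  values leaves \<open>'a\<close> free of linear structure, so that it can be a function space.
\<close>

lemma concave_like_alternative:
  fixes f :: "'a::topological_space \<Rightarrow> 'e::ordered_euclidean_space"
  assumes C: "compact C" "C \<noteq> {}" and f: "continuous_on C f"
    and mix: "\<And>P Q t. P \<in> C \<Longrightarrow> Q \<in> C \<Longrightarrow> 0 \<le> t \<Longrightarrow> t \<le> 1 \<Longrightarrow>
      \<exists>R\<in>C. (1 - t) *\<^sub>R f P + t *\<^sub>R f Q \<le> f R"
    and none: "\<And>P. P \<in> C \<Longrightarrow> \<not> 0 \<le> f P"
  obtains l where "\<And>i. i \<in> Basis \<Longrightarrow> 0 \<le> l \<bullet> i" "\<And>P. P \<in> C \<Longrightarrow> l \<bullet> f P < 0"
proof -
  define K where "K = {u. \<exists>P\<in>C. u \<le> f P}"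
  have K_sum: "K = (\<Union>x\<in>f ` C. \<Union>y\<in>{..0}. {x + y})"
  proof (intro set_eqI iffI)
    fix u assume "u \<in> K"
    then obtain P where P: "P \<in> C" "u \<le> f P" by (auto simp: K_def)
    then have "u = f P + (u - f P)" "u - f P \<in> {..0}" by simp_all
    with P(1) show "u \<in> (\<Union>x\<in>f ` C. \<Union>y\<in>{..0}. {x + y})" by blast
  next
    fix u assume "u \<in> (\<Union>x\<in>f ` C. \<Union>y\<in>{..0}. {x + y})"
    then obtain P y where "P \<in> C" "y \<le> 0" "u = f P + y" by auto
    then show "u \<in> K" unfolding K_def by (auto intro!: bexI[of _ P] simp: add_nonpos_nonpos)
  qed
  have "closed K"
    unfolding K_sum
    by (intro compact_closed_sums compact_continuous_image f C closed_eucl_atMost)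
  moreover have "convex K"
    unfolding convex_alt
  proof (intro ballI allI impI)
    fix u v and t :: real
    assume "u \<in> K" "v \<in> K" and t: "0 \<le> t \<and> t \<le> 1"
    then obtain P Q where PQ: "P \<in> C" "u \<le> f P" "Q \<in> C" "v \<le> f Q" by (auto simp: K_def)
    from mix[OF PQ(1,3)] t obtain R where R: "R \<in> C" "(1 - t) *\<^sub>R f P + t *\<^sub>R f Q \<le> f R" by blast
    have "(1 - t) *\<^sub>R u + t *\<^sub>R v \<le> (1 - t) *\<^sub>R f P + t *\<^sub>R f Q"
      using PQ t by (intro add_mono scaleR_left_mono) auto
    with R show "(1 - t) *\<^sub>R u + t *\<^sub>R v \<in> K"
      unfolding K_def by (blast intro: order_trans)
  qed
  moreover have "0 \<notin> K" using none by (auto simp: K_def)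
  ultimately obtain a b where ab: "0 < b" "\<And>u. u \<in> K \<Longrightarrow> b < a \<bullet> u"
    using separating_hyperplane_closed_0 by metis
  have "a \<bullet> i \<le> 0" if i: "i \<in> Basis" for i
  proof (rule ccontr)
    assume pos: "\<not> a \<bullet> i \<le> 0"
    obtain P where P: "P \<in> C" using C by blast
    \<comment> \<open>the dominated set is unbounded in direction \<open>- i\<close>; this step length makes \<open>a\<close> nonpositive there\<close>
    define t where "t = \<bar>a \<bullet> f P\<bar> / (a \<bullet> i)"
    have "0 \<le> i" using i by (subst eucl_le) (simp add: inner_Basis)
    then have "0 \<le> t *\<^sub>R i" using pos by (intro scaleR_nonneg_nonneg) (simp_all add: t_def)
    then have "f P - t *\<^sub>R i \<in> K"
      using P by (auto simp: K_def intro!: bexI[of _ P])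
    from ab(2)[OF this] ab(1) pos show False by (simp add: inner_diff_right t_def)
  qed
  moreover have "a \<bullet> f P > 0" if "P \<in> C" for P
    using ab(1) ab(2)[of "f P"] that by (force simp: K_def)
  ultimately show thesis by (intro that[of "- a"]) auto
qed

section \<open>Relative entropy on a finite simplex\<close>

text \<open>
  The affine minorants of \<open>x ln (x / q)\<close>, with equality at \<open>t = ln (x / q)\<close>. Unlike derivatives, they
  also cover the boundary point \<open>x = 0\<close>. Convexity and the Gibbs inequality both follow by choosing
  \<open>t\<close>.
\<close>

lemma relative_entropy_tangent:
  fixes x q t :: real
  assumes "0 \<le> x" "0 < q"
  shows "x * t + x - q * exp t \<le> x * ln (x / q)"
proof (cases "x = 0")
  case False
  then have x: "0 < x" using assms by simp
  have "ln (q * exp t / x) \<le> q * exp t / x - 1"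
    using x assms by (intro ln_le_minus_one) simp
  moreover have "ln (q * exp t / x) = t - ln (x / q)"
    using x assms by (simp add: ln_div ln_mult)
  ultimately have "x * (t - ln (x / q)) \<le> x * (q * exp t / x - 1)"
    using x by (simp add: mult_left_mono)
  then show ?thesis using x by (simp add: algebra_simps)
qed (use assms in simp)

lemma relative_entropy_convex:
  fixes q :: real
  assumes "0 < q" "0 \<le> x" "0 \<le> y" "0 \<le> t" "t \<le> 1"
  defines "m \<equiv> (1 - t) * x + t * y"
  shows "m * ln (m / q) \<le> (1 - t) * (x * ln (x / q)) + t * (y * ln (y / q))"
proof (cases "m = 0")
  case True
  then have "(1 - t) * x = 0" "t * y = 0"
    using assms by (auto simp: m_def add_nonneg_eq_0_iff)
  then show ?thesis using True by auto
next
  case False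
  then have m: "0 < m" using assms by (simp add: m_def order_less_le)
  \<comment> \<open>average the minorant that touches at the mixture \<open>m\<close>\<close>
  define s where "s = ln (m / q)"
  have qs: "q * exp s = m" using m assms(1) by (simp add: s_def)
  have "(1 - t) * (x * s + x - q * exp s) + t * (y * s + y - q * exp s)
      \<le> (1 - t) * (x * ln (x / q)) + t * (y * ln (y / q))"
    using assms by (intro add_mono mult_left_mono relative_entropy_tangent) auto
  moreover have "(1 - t) * (x * s + x - q * exp s) + t * (y * s + y - q * exp s) = m * s"
    unfolding qs by (simp add: m_def algebra_simps)
  ultimately show ?thesis by (simp add: s_def)
qed

lemma continuous_on_relative_entropy:
  fixes q :: real
  assumes "0 < q"
  shows "continuous_on {0..} (\<lambda>x. x * ln (x / q))"
  unfolding continuous_on_def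
proof
  fix x :: real assume "x \<in> {0..}"
  then consider "x = 0" | "0 < x" by force
  then show "((\<lambda>x. x * ln (x / q)) \<longlongrightarrow> x * ln (x / q)) (at x within {0..})"
  proof cases
    case 1
    have "((\<lambda>x. x * ln (x / q)) \<longlongrightarrow> 0) (at_right 0)" using assms by real_asymp
    then show ?thesis using 1 by (simp add: at_within_Ici_at_right)
  next
    case 2
    then show ?thesis using assms by (intro tendsto_intros) auto
  qed
qed

text \<open>
  The value \<open>0\<close> outside \<open>T\<close> is what makes this set compact in the product topology on all functions.
\<close>

definition prob_simplex :: "'p set \<Rightarrow> ('p \<Rightarrow> real) set" where
  "prob_simplex T = {Q. (\<forall>p\<in>T. 0 \<le> Q p) \<and> (\<forall>p. p \<notin> T \<longrightarrow> Q p = 0) \<and> sum Q T = 1}"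

lemma compact_simplex:
  assumes "finite T"
  shows "compact (prob_simplex T)"
proof -
  \<comment> \<open>Tychonoff: a product of unit intervals and singletons\<close>
  define B where "B = PiE UNIV (\<lambda>p. if p \<in> T then {0..1::real} else {0})"
  have "compactin (product_topology (\<lambda>_. euclidean) UNIV) B"
    by (auto simp: B_def compactin_PiE)
  then have "compact B" by (simp add: euclidean_product_topology)
  moreover have "closed ((\<lambda>Q. sum Q T) -` {1::real})"
    by (intro closed_vimage continuous_on_sum) auto
  moreover have "prob_simplex T = B \<inter> (\<lambda>Q. sum Q T) -` {1}"
  proof -
    have "Q p \<le> 1" if "Q \<in> prob_simplex T" "p \<in> T" for Q p
      using that assms member_le_sum[of p T Q] by (auto simp: prob_simplex_def)
    then show ?thesis
      by (force simp: B_def prob_simplex_def PiE_def Pi_def split: if_splits)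
  qed
  ultimately show ?thesis by (simp add: compact_Int_closed)
qed

lemma continuous_on_coordinate: "continuous_on A (\<lambda>Q::'p \<Rightarrow> real. Q p)"
  by (rule continuous_on_subset[OF continuous_on_product_coordinates]) simp

lemma simplex_mix:
  assumes "P \<in> prob_simplex T" "Q \<in> prob_simplex T" "0 \<le> t" "t \<le> 1"
  shows "(\<lambda>p. (1 - t) * P p + t * Q p) \<in> prob_simplex T"
  using assms by (auto simp: prob_simplex_def sum.distrib simp flip: sum_distrib_left)

abbreviation rel_entropy :: "'p set \<Rightarrow> ('p \<Rightarrow> real) \<Rightarrow> ('p \<Rightarrow> real) \<Rightarrow> real" where
  "rel_entropy T q Q \<equiv> (\<Sum>p\<in>T. Q p * ln (Q p / q p))"

text \<open>
  The convex conjugate of \<open>\<nu>\<close> times the relative entropy to \<open>q\<close> on the simplex, evaluated at \<open>a\<close>: a smoothed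
  maximum of \<open>a\<close> at temperature \<open>\<nu>\<close>, which becomes the maximum itself at \<open>\<nu> = 0\<close>. The next two
  lemmas are Gibbs' variational principle.
\<close>

definition soft_max :: "'p set \<Rightarrow> ('p \<Rightarrow> real) \<Rightarrow> ('p \<Rightarrow> real) \<Rightarrow> real \<Rightarrow> real" where
  "soft_max T q a \<nu> =
     (if \<nu> = 0 then Max (a ` T) else \<nu> * ln (\<Sum>p\<in>T. exp (a p / \<nu>) * q p))"

lemma soft_max_upper:
  assumes T: "finite T" "\<And>p. p \<in> T \<Longrightarrow> 0 < q p" and Q: "Q \<in> prob_simplex T" and \<nu>: "0 \<le> \<nu>"
  shows "(\<Sum>p\<in>T. a p * Q p) - \<nu> * rel_entropy T q Q \<le> soft_max T q a \<nu>"
proof (cases "\<nu> = 0")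
  case True
  have "(\<Sum>p\<in>T. a p * Q p) \<le> (\<Sum>p\<in>T. Max (a ` T) * Q p)"
    using T Q by (intro sum_mono mult_right_mono) (auto simp: prob_simplex_def)
  also have "\<dots> = Max (a ` T)"
    using Q by (simp add: prob_simplex_def flip: sum_distrib_left)
  finally show ?thesis using True by (simp add: soft_max_def)
next
  case False
  define Z where "Z = (\<Sum>p\<in>T. exp (a p / \<nu>) * q p)"
  have "T \<noteq> {}" using Q by (auto simp: prob_simplex_def)
  then have Z: "0 < Z" unfolding Z_def using T by (intro sum_pos) auto
  \<comment> \<open>the minorants that touch at the tilted distribution \<open>q p * exp (a p / \<nu>) / Z\<close>\<close>
  have "(\<Sum>p\<in>T. Q p * (a p / \<nu> - ln Z) + Q p - q p * exp (a p / \<nu> - ln Z))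
      \<le> (\<Sum>p\<in>T. Q p * ln (Q p / q p))"
    using T Q by (intro sum_mono relative_entropy_tangent) (auto simp: prob_simplex_def)
  moreover have "(\<Sum>p\<in>T. q p * exp (a p / \<nu> - ln Z)) = 1"
    using Z by (simp add: exp_diff Z_def mult.commute flip: sum_divide_distrib)
  ultimately have "(\<Sum>p\<in>T. a p * Q p) / \<nu> - ln Z \<le> (\<Sum>p\<in>T. Q p * ln (Q p / q p))"
    using Q by (simp add: prob_simplex_def right_diff_distrib sum.distrib sum_subtractf sum_divide_distrib
        mult.commute flip: sum_distrib_right sum_distrib_left)
  then have "\<nu> * ((\<Sum>p\<in>T. a p * Q p) / \<nu> - ln Z) \<le> \<nu> * (\<Sum>p\<in>T. Q p * ln (Q p / q p))"
    using \<nu> by (rule mult_left_mono)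
  then show ?thesis using False by (simp add: soft_max_def Z_def algebra_simps)
qed

text \<open>
  The maximiser is the exponentially tilted distribution, or a point mass if \<open>\<nu> = 0\<close>.
\<close>

lemma soft_max_attained:
  assumes T: "finite T" "T \<noteq> {}" "\<And>p. p \<in> T \<Longrightarrow> 0 < q p"
  obtains Q where "Q \<in> prob_simplex T"
    "soft_max T q a \<nu> = (\<Sum>p\<in>T. a p * Q p) - \<nu> * rel_entropy T q Q"
proof (cases "\<nu> = 0")
  case True
  have "Max (a ` T) \<in> a ` T" using T by (intro Max_in) auto
  then obtain m where m: "m \<in> T" "Max (a ` T) = a m" by blast
  show thesis
  proof (rule that[of "\<lambda>p. if p = m then 1 else 0"])
    show "(\<lambda>p. if p = m then 1 else 0) \<in> prob_simplex T" using m T by (auto simp: prob_simplex_def)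
  qed (use True m T in \<open>simp add: soft_max_def if_distrib cong: if_cong\<close>)
next
  case False
  define Z where "Z = (\<Sum>p\<in>T. exp (a p / \<nu>) * q p)"
  have Z: "0 < Z" unfolding Z_def using T by (intro sum_pos) auto
  define Q where "Q = (\<lambda>p. if p \<in> T then exp (a p / \<nu>) * q p / Z else 0)"
  have Q: "Q \<in> prob_simplex T"
    using Z T by (auto simp: prob_simplex_def Q_def Z_def less_imp_le simp flip: sum_divide_distrib)
  have "Q p * ln (Q p / q p) = Q p * (a p / \<nu> - ln Z)" if "p \<in> T" for p
  proof -
    have "q p > 0" using T that by simp
    then have "Q p / q p = exp (a p / \<nu>) / Z" using that by (simp add: Q_def)
    then show ?thesis using Z by (simp add: ln_div)
  qed
  then have "(\<Sum>p\<in>T. Q p * ln (Q p / q p)) = (\<Sum>p\<in>T. Q p * (a p / \<nu> - ln Z))"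
    by (intro sum.cong) auto
  also have "\<dots> = (\<Sum>p\<in>T. a p * Q p) / \<nu> - ln Z"
    using Q by (simp add: prob_simplex_def right_diff_distrib sum_subtractf sum_divide_distrib
        mult.commute flip: sum_distrib_left sum_distrib_right)
  finally show thesis
    using False by (intro that[OF Q]) (simp add: soft_max_def Z_def right_diff_distrib)
qed


section \<open>Lagrangian duality over an entropy ball\<close>

lemma entropy_weak_duality:
  assumes T: "finite T" "\<And>p. p \<in> T \<Longrightarrow> 0 < q p"
    and Q: "Q \<in> prob_simplex T" "\<beta> \<le> (\<Sum>p\<in>T. b p * Q p)" "\<gamma> \<le> (\<Sum>p\<in>T. c p * Q p)"
      "rel_entropy T q Q \<le> r"
    and mult: "0 \<le> \<eta>1" "0 \<le> \<eta>2" "0 \<le> \<nu>"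
    and dual: "soft_max T q (\<lambda>p. a p + \<eta>1 * b p + \<eta>2 * c p) \<nu> + r * \<nu> - \<eta>1 * \<beta> - \<eta>2 * \<gamma> \<le> 0"
  shows "(\<Sum>p\<in>T. a p * Q p) \<le> 0"
proof -
  have "(\<Sum>p\<in>T. (a p + \<eta>1 * b p + \<eta>2 * c p) * Q p) - \<nu> * rel_entropy T q Q
      \<le> soft_max T q (\<lambda>p. a p + \<eta>1 * b p + \<eta>2 * c p) \<nu>"
    using T Q mult by (intro soft_max_upper) auto
  moreover have "(\<Sum>p\<in>T. (a p + \<eta>1 * b p + \<eta>2 * c p) * Q p)
      = (\<Sum>p\<in>T. a p * Q p) + \<eta>1 * (\<Sum>p\<in>T. b p * Q p) + \<eta>2 * (\<Sum>p\<in>T. c p * Q p)"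
    by (simp add: distrib_right sum.distrib sum_distrib_left mult.assoc)
  moreover have "\<eta>1 * \<beta> \<le> \<eta>1 * (\<Sum>p\<in>T. b p * Q p)" "\<eta>2 * \<gamma> \<le> \<eta>2 * (\<Sum>p\<in>T. c p * Q p)"
    "\<nu> * rel_entropy T q Q \<le> r * \<nu>"
    using Q mult by (auto intro: mult_left_mono simp: mult.commute[of r])
  ultimately show ?thesis using dual by linarith
qed

text \<open>
  The alternative applied to objective and slacks. The feasible point \<open>Q0\<close> has nonnegative slacks, so
  a separating functional with zero weight on the objective would be nonnegative there; dividing by
  the positive weight gives the multipliers. The Lagrangian is negative at every \<open>Q\<close>, in particular
  at the one where \<open>soft_max\<close> is attained.
\<close>

lemma entropy_multipliers:
  assumes T: "finite T" "\<And>p. p \<in> T \<Longrightarrow> 0 < q p"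
    and Q0: "Q0 \<in> prob_simplex T" "\<beta> \<le> (\<Sum>p\<in>T. b p * Q0 p)" "\<gamma> \<le> (\<Sum>p\<in>T. c p * Q0 p)"
      "rel_entropy T q Q0 \<le> r"
    and neg: "\<And>Q. Q \<in> prob_simplex T \<Longrightarrow> \<beta> \<le> (\<Sum>p\<in>T. b p * Q p) \<Longrightarrow> \<gamma> \<le> (\<Sum>p\<in>T. c p * Q p) \<Longrightarrow>
      rel_entropy T q Q \<le> r \<Longrightarrow> (\<Sum>p\<in>T. a p * Q p) < 0"
  obtains \<eta>1 \<eta>2 \<nu> where "0 \<le> \<eta>1" "0 \<le> \<eta>2" "0 \<le> \<nu>"
    "soft_max T q (\<lambda>p. a p + \<eta>1 * b p + \<eta>2 * c p) \<nu> + r * \<nu> - \<eta>1 * \<beta> - \<eta>2 * \<gamma> < 0"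
proof -
  define f where "f Q = ((\<Sum>p\<in>T. a p * Q p), (\<Sum>p\<in>T. b p * Q p) - \<beta>, (\<Sum>p\<in>T. c p * Q p) - \<gamma>,
    r - rel_entropy T q Q)" for Q :: "'a \<Rightarrow> real"
  have "continuous_on (prob_simplex T) (\<lambda>Q. Q p * ln (Q p / q p))" if "p \<in> T" for p
    by (rule continuous_on_compose2[OF continuous_on_relative_entropy continuous_on_coordinate])
      (use T that in \<open>auto simp: prob_simplex_def\<close>)
  then have cont: "continuous_on (prob_simplex T) f"
    unfolding f_def
    by (intro continuous_on_Pair continuous_on_diff continuous_on_const continuous_on_sum
        continuous_on_mult_left continuous_on_coordinate)
  have mix: "\<exists>R\<in>prob_simplex T. (1 - t) *\<^sub>R f P + t *\<^sub>R f Q \<le> f R"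
    if PQ: "P \<in> prob_simplex T" "Q \<in> prob_simplex T" and t: "0 \<le> t" "t \<le> 1" for P Q t
  proof
    let ?R = "\<lambda>p. (1 - t) * P p + t * Q p"
    have lin: "(\<Sum>p\<in>T. e p * ?R p) = (1 - t) * (\<Sum>p\<in>T. e p * P p) + t * (\<Sum>p\<in>T. e p * Q p)" for e
      by (simp add: distrib_left sum.distrib sum_distrib_left mult.left_commute)
    have "rel_entropy T q ?R
        \<le> (\<Sum>p\<in>T. (1 - t) * (P p * ln (P p / q p)) + t * (Q p * ln (Q p / q p)))"
      using T PQ t by (intro sum_mono relative_entropy_convex) (auto simp: prob_simplex_def)
    also have "\<dots> = (1 - t) * rel_entropy T q P + t * rel_entropy T q Q"
      by (simp add: sum.distrib sum_distrib_left)
    finally show "(1 - t) *\<^sub>R f P + t *\<^sub>R f Q \<le> f ?R"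
      unfolding f_def lin by (simp add: algebra_simps)
    show "?R \<in> prob_simplex T" using PQ t by (rule simplex_mix)
  qed
  have none: "\<not> 0 \<le> f Q" if "Q \<in> prob_simplex T" for Q
    using neg[OF that] by (fastforce simp: f_def zero_prod_def)
  obtain l where l: "\<And>i. i \<in> Basis \<Longrightarrow> 0 \<le> l \<bullet> i" "\<And>Q. Q \<in> prob_simplex T \<Longrightarrow> l \<bullet> f Q < 0"
    using concave_like_alternative[OF compact_simplex[OF T(1)] _ cont mix none] Q0(1) by blast
  obtain l0 l1 l2 l3 where l_eq: "l = (l0, l1, l2, l3)" by (cases l)
  have nonneg: "0 \<le> l0" "0 \<le> l1" "0 \<le> l2" "0 \<le> l3"
    using l(1)[of "(1, 0, 0, 0)"] l(1)[of "(0, 1, 0, 0)"] l(1)[of "(0, 0, 1, 0)"]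
      l(1)[of "(0, 0, 0, 1)"]
    by (simp_all add: l_eq Basis_prod_def zero_prod_def image_iff)
  have lagr: "l0 * (\<Sum>p\<in>T. a p * Q p) + l1 * ((\<Sum>p\<in>T. b p * Q p) - \<beta>)
      + l2 * ((\<Sum>p\<in>T. c p * Q p) - \<gamma>) + l3 * (r - rel_entropy T q Q) < 0"
    if "Q \<in> prob_simplex T" for Q
    using l(2)[OF that] by (simp add: l_eq f_def)
  have "0 < l0"
  proof (rule ccontr)
    assume "\<not> 0 < l0"
    then have "l0 = 0" using nonneg by simp
    moreover have "0 \<le> l1 * ((\<Sum>p\<in>T. b p * Q0 p) - \<beta>)" "0 \<le> l2 * ((\<Sum>p\<in>T. c p * Q0 p) - \<gamma>)"
      "0 \<le> l3 * (r - rel_entropy T q Q0)"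
      using nonneg Q0 by (simp_all add: mult_nonneg_nonneg)
    ultimately show False using lagr[OF Q0(1)] by simp
  qed
  define \<eta>1 \<eta>2 \<nu> where mult: "\<eta>1 = l1 / l0" "\<eta>2 = l2 / l0" "\<nu> = l3 / l0"
  have "T \<noteq> {}" using Q0(1) by (auto simp: prob_simplex_def)
  then obtain Q where Q: "Q \<in> prob_simplex T"
    "soft_max T q (\<lambda>p. a p + \<eta>1 * b p + \<eta>2 * c p) \<nu>
      = (\<Sum>p\<in>T. (a p + \<eta>1 * b p + \<eta>2 * c p) * Q p) - \<nu> * rel_entropy T q Q"
    using soft_max_attained[where T = T and q = q and \<nu> = \<nu>
        and a = "\<lambda>p. a p + \<eta>1 * b p + \<eta>2 * c p"] T by blast
  have "soft_max T q (\<lambda>p. a p + \<eta>1 * b p + \<eta>2 * c p) \<nu>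
      = (\<Sum>p\<in>T. a p * Q p) + \<eta>1 * (\<Sum>p\<in>T. b p * Q p) + \<eta>2 * (\<Sum>p\<in>T. c p * Q p)
        - \<nu> * rel_entropy T q Q"
    unfolding Q(2) by (simp add: distrib_right sum.distrib sum_distrib_left mult.assoc)
  then have "l0 * (soft_max T q (\<lambda>p. a p + \<eta>1 * b p + \<eta>2 * c p) \<nu> + r * \<nu> - \<eta>1 * \<beta> - \<eta>2 * \<gamma>)
      = l0 * (\<Sum>p\<in>T. a p * Q p) + l1 * ((\<Sum>p\<in>T. b p * Q p) - \<beta>)
      + l2 * ((\<Sum>p\<in>T. c p * Q p) - \<gamma>) + l3 * (r - rel_entropy T q Q)" (is "l0 * ?X = _")
    using \<open>0 < l0\<close> by (simp add: mult right_diff_distrib distrib_left)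
  then have "l0 * ?X < l0 * 0" using lagr[OF Q(1)] by simp
  then have "?X < 0" using \<open>0 < l0\<close> by (rule mult_less_cancel_left_pos[THEN iffD1, rotated])
  then show thesis using nonneg \<open>0 < l0\<close> by (intro that[of \<eta>1 \<eta>2 \<nu>]) (auto simp: mult)
qed

section \<open>Nested neighborhoods\<close>

text \<open>
  A least element of a set of reals need not exist. Here it does, because the number of data points
  within \<open>\<rho>\<close> only jumps at the finitely many distances that occur: any admissible radius can be
  lowered to such a distance.
\<close>

lemma nbhd_radius_minimal:
  fixes d :: "nat \<Rightarrow> ('dx::finite, 'dy::finite) point"
  assumes nonneg: "\<And>i. i \<in> {1..n} \<Longrightarrow> 0 \<le> dst (d i) x0" and j: "1 \<le> j" "j \<le> n"
  defines "enough \<equiv> \<lambda>\<rho>. 0 \<le> \<rho> \<and> j \<le> card {i \<in> {1..n}. dst (d i) x0 \<le> \<rho>}"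
  shows "enough (nbhd_radius n d dst x0 j)"
    and "enough \<rho> \<Longrightarrow> nbhd_radius n d dst x0 j \<le> \<rho>"
proof -
  define A where "A = {a \<in> (\<lambda>i. dst (d i) x0) ` {1..n}. enough a}"
  have lower: "\<exists>a\<in>A. a \<le> \<rho>" if \<rho>: "enough \<rho>" for \<rho>
  proof -
    let ?I = "{i \<in> {1..n}. dst (d i) x0 \<le> \<rho>}"
    let ?a = "Max ((\<lambda>i. dst (d i) x0) ` ?I)"
    have ne: "(\<lambda>i. dst (d i) x0) ` ?I \<noteq> {}"
    proof
      assume "(\<lambda>i. dst (d i) x0) ` ?I = {}"
      then have "?I = {}" by (rule image_is_empty[THEN iffD1])
      then have "card ?I = 0" by (simp only: card.empty)
      then show False using \<rho> j unfolding enough_def by linarith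
    qed
    have a: "?a \<in> (\<lambda>i. dst (d i) x0) ` ?I" using ne by (intro Max_in) auto
    have "?I \<subseteq> {i \<in> {1..n}. dst (d i) x0 \<le> ?a}" by (auto intro!: Max_ge)
    then have "card ?I \<le> card {i \<in> {1..n}. dst (d i) x0 \<le> ?a}" by (intro card_mono) auto
    then have "j \<le> card {i \<in> {1..n}. dst (d i) x0 \<le> ?a}"
      using \<rho> by (auto simp: enough_def)
    moreover have "0 \<le> ?a" using a nonneg by auto
    ultimately have "enough ?a" by (simp add: enough_def)
    with a show ?thesis by (intro bexI[of _ ?a]) (auto simp: A_def)
  qed
  define M where "M = Max ((\<lambda>i. dst (d i) x0) ` {1..n})"
  have M: "dst (d i) x0 \<le> M" if "i \<in> {1..n}" for i
    unfolding M_def using that by (intro Max_ge) auto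
  then have "{i \<in> {1..n}. dst (d i) x0 \<le> M} = {1..n}" by auto
  moreover have "0 \<le> M" using M[of 1] nonneg[of 1] j by auto
  ultimately have "enough M" using j by (simp add: enough_def)
  then have "A \<noteq> {}" "finite A" using lower by (auto simp: A_def)
  then have "Min A \<in> A" by (intro Min_in)
  have least: "Min A \<le> \<rho>" if "enough \<rho>" for \<rho>
    using lower[OF that] \<open>finite A\<close> by (meson Min_le order_trans)
  have "nbhd_radius n d dst x0 j = Min A"
    unfolding nbhd_radius_def enough_def[symmetric]
    using \<open>Min A \<in> A\<close> least by (intro Least_equality) (auto simp: A_def enough_def)
  then show "enough (nbhd_radius n d dst x0 j)"
    and "enough \<rho> \<Longrightarrow> nbhd_radius n d dst x0 j \<le> \<rho>"
    using \<open>Min A \<in> A\<close> least by (auto simp: A_def)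
qed

lemma nbhd_mono:
  fixes d :: "nat \<Rightarrow> ('dx::finite, 'dy::finite) point"
  assumes nonneg: "\<And>i. i \<in> {1..n} \<Longrightarrow> 0 \<le> dst (d i) x0" and "i \<le> j" "j \<le> n"
  shows "nbhd n d dst x0 i \<subseteq> nbhd n d dst x0 j"
proof (cases "i = 0")
  case False
  have "nbhd_radius n d dst x0 i \<le> nbhd_radius n d dst x0 j"
    using nbhd_radius_minimal(1)[of n dst d x0 j] nonneg False assms(2,3)
    by (intro nbhd_radius_minimal(2)) auto
  then show ?thesis using False \<open>i \<le> j\<close> by (auto simp: nbhd_def)
qed (simp add: nbhd_def)

section \<open>The budget problem and its dual\<close>

text \<open>
  The two problems for an arbitrary finite set \<open>S\<close> with reference masses \<open>q\<close>, weights \<open>wt\<close> and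
  real losses \<open>l\<close>. The mass bounds are \<open>\<kappa> = k / n\<close> on the outer and \<open>\<kappa>' = (k - 1) / n\<close> on the
  inner neighborhood.
\<close>

locale partial_problem =
  fixes S N N' :: "'p set" and q wt l :: "'p \<Rightarrow> real" and \<kappa> \<kappa>' r :: real
  assumes finite: "finite S" and nested: "N' \<subseteq> N" "N \<subseteq> S"
    and q_nonneg: "\<And>p. 0 \<le> q p"
    and wt_pos: "\<And>p. p \<in> N \<Longrightarrow> 0 < wt p" and \<kappa>_pos: "0 < \<kappa>"
begin

definition T :: "'p set" where "T = {p \<in> S. 0 < q p}"

definition scaled_feasible :: "real \<Rightarrow> ('p \<Rightarrow> real) \<Rightarrow> bool" where
  "scaled_feasible s P \<longleftrightarrow> 0 < s \<and> (\<forall>p\<in>S. 0 \<le> P p) \<and>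
     ereal s * bootstrap_dist S (\<lambda>p. P p / s) q \<le> ereal (s * r) \<and> (\<Sum>p\<in>S. P p) = s \<and>
     (\<Sum>p\<in>N. wt p * P p) = 1 \<and> (\<Sum>p\<in>N. P p) \<ge> s * \<kappa> \<and> (\<Sum>p\<in>N'. P p) \<le> s * \<kappa>'"

text \<open>
  The constraints on \<open>Q = P / s\<close>; finiteness of the entropy has become the support condition.
\<close>

definition feasible :: "('p \<Rightarrow> real) \<Rightarrow> bool" where
  "feasible Q \<longleftrightarrow> Q \<in> prob_simplex T \<and> rel_entropy T q Q \<le> r \<and>
     \<kappa> \<le> (\<Sum>p\<in>N. Q p) \<and> (\<Sum>p\<in>N'. Q p) \<le> \<kappa>'"

definition multiplier_feasible :: "real \<Rightarrow> real \<Rightarrow> real \<Rightarrow> real \<Rightarrow> bool" where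
  "multiplier_feasible \<alpha> \<eta>1 \<eta>2 \<nu> \<longleftrightarrow> 0 \<le> \<eta>1 \<and> 0 \<le> \<eta>2 \<and> 0 \<le> \<nu> \<and>
     dual_log_term S N N' q (\<lambda>p. (l p - \<alpha>) * wt p) \<eta>1 \<eta>2 \<nu> + r * \<nu> - \<eta>1 * \<kappa> + \<eta>2 * \<kappa>' \<le> 0"

lemma T: "finite T" "T \<subseteq> S" "\<And>p. p \<in> T \<Longrightarrow> 0 < q p"
  using finite by (auto simp: T_def)

lemma q_off_T: "p \<in> S \<Longrightarrow> p \<notin> T \<Longrightarrow> q p = 0"
  using q_nonneg[of p] by (auto simp: T_def)

lemma sum_restrict_T:
  assumes "Q \<in> prob_simplex T" "A \<subseteq> S"
  shows "(\<Sum>p\<in>A. g p * Q p) = (\<Sum>p\<in>T. (g p * indicator A p) * Q p)"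
proof -
  have "(\<Sum>p\<in>A. g p * Q p) = (\<Sum>p\<in>A \<inter> T. g p * Q p)"
    using assms finite by (intro sum.mono_neutral_right) (auto simp: prob_simplex_def finite_subset)
  also have "\<dots> = (\<Sum>p\<in>T. (g p * indicator A p) * Q p)"
    using T by (intro sum.mono_neutral_cong_left) (auto simp: indicator_def)
  finally show ?thesis .
qed

lemma bootstrap_dist_simplex:
  assumes "Q \<in> prob_simplex T"
  shows "bootstrap_dist S Q q = ereal (rel_entropy T q Q)"
proof -
  have "(\<Sum>p\<in>S. Q p * ln (Q p / q p)) = rel_entropy T q Q"
    using assms T finite by (intro sum.mono_neutral_right) (auto simp: prob_simplex_def)
  moreover have "Q p = 0" if "q p = 0" for p
    using assms that by (auto simp: prob_simplex_def T_def)
  ultimately show ?thesis by (simp add: bootstrap_dist_def)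
qed

lemma simplex_of_finite_dist:
  assumes "bootstrap_dist S Q q < \<infinity>" "\<And>p. p \<in> S \<Longrightarrow> 0 \<le> Q p" "sum Q S = 1"
    "\<And>p. p \<notin> S \<Longrightarrow> Q p = 0"
  shows "Q \<in> prob_simplex T"
proof -
  have ac: "q p = 0 \<Longrightarrow> Q p = 0" if "p \<in> S" for p
    using assms(1) that by (auto simp: bootstrap_dist_def split: if_splits)
  have off: "Q p = 0" if "p \<notin> T" for p
    using that ac q_off_T assms(4) by (cases "p \<in> S") auto
  then have "sum Q T = sum Q S" using T finite by (intro sum.mono_neutral_left) auto
  then show ?thesis using off assms(2,3) T by (auto simp: prob_simplex_def)
qed

text \<open>
  \<open>P\<close> is unconstrained outside \<open>S\<close>, so the normalised function is cut off there.
\<close>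

lemma feasible_normalise:
  assumes "scaled_feasible s P"
  obtains Q where "feasible Q" "\<And>p. p \<in> S \<Longrightarrow> P p = s * Q p"
proof
  define Q where "Q p = (if p \<in> S then P p / s else 0)" for p
  have s: "0 < s" using assms by (simp add: scaled_feasible_def)
  show PQ: "P p = s * Q p" if "p \<in> S" for p using that s by (simp add: Q_def)
  have eq: "bootstrap_dist S (\<lambda>p. P p / s) q = bootstrap_dist S Q q"
    by (simp add: bootstrap_dist_def Q_def cong: sum.cong)
  have le: "ereal s * bootstrap_dist S Q q \<le> ereal (s * r)"
    using assms by (simp add: scaled_feasible_def eq)
  then have fin: "bootstrap_dist S Q q < \<infinity>" using s by (cases "bootstrap_dist S Q q") auto
  have "sum Q S = (\<Sum>p\<in>S. P p / s)" by (simp add: Q_def)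
  also have "\<dots> = 1" using assms s by (simp add: scaled_feasible_def flip: sum_divide_distrib)
  finally have Q: "Q \<in> prob_simplex T"
    using assms s fin by (intro simplex_of_finite_dist) (auto simp: Q_def scaled_feasible_def)
  have "(\<Sum>p\<in>A. P p) = s * (\<Sum>p\<in>A. Q p)" if "A \<subseteq> S" for A
    using that PQ by (auto simp: sum_distrib_left intro!: sum.cong)
  then have "s * \<kappa> \<le> s * (\<Sum>p\<in>N. Q p)" "s * (\<Sum>p\<in>N'. Q p) \<le> s * \<kappa>'"
    using assms nested by (auto simp: scaled_feasible_def)
  moreover have "rel_entropy T q Q \<le> r" using le s by (simp add: bootstrap_dist_simplex[OF Q])
  ultimately show "feasible Q" using Q s by (simp add: feasible_def)
qed

text \<open>
  The mass \<open>s = 1 / W\<close> is forced by the normalisation of the weighted mass. It is well defined since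
  \<open>Q\<close> charges \<open>N\<close>, where the weights are positive.
\<close>

lemma feasible_rescale:
  assumes Q: "feasible Q"
  defines "W \<equiv> \<Sum>p\<in>N. wt p * Q p"
  shows "0 < W" "scaled_feasible (1 / W) (\<lambda>p. Q p / W)"
proof -
  have Q0: "0 \<le> Q p" for p using Q by (cases "p \<in> T") (auto simp: feasible_def prob_simplex_def)
  have "finite N" using finite_subset[OF nested(2) finite] .
  have "0 < (\<Sum>p\<in>N. Q p)" using Q \<kappa>_pos by (simp add: feasible_def)
  then obtain p where "p \<in> N" "0 < Q p" by (meson leD not_le sum_nonpos)
  then show W: "0 < W"
    unfolding W_def using \<open>finite N\<close> wt_pos Q0
    by (intro sum_pos2[of N p]) (auto simp: mult_nonneg_nonneg less_imp_le)
  have simp_T: "Q \<in> prob_simplex T" using Q by (simp add: feasible_def)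
  have "sum Q S = 1"
    using simp_T T finite by (subst sum.mono_neutral_right[of S T]) (auto simp: prob_simplex_def)
  then show "scaled_feasible (1 / W) (\<lambda>p. Q p / W)"
    using Q Q0 W bootstrap_dist_simplex[OF simp_T]
    by (auto simp: scaled_feasible_def feasible_def W_def divide_right_mono
        simp flip: sum_divide_distrib)
qed

text \<open>
  The exponents are the coefficients of \<open>Q p\<close> in the Lagrangian: \<open>\<eta>1\<close> multiplies the slack of the
  lower bound on \<open>Q N\<close>, and \<open>\<eta>2\<close> that of the upper bound on \<open>Q N'\<close>, read as a lower bound on
  \<open>- Q N'\<close>. As \<open>N'\<close> lies in \<open>N\<close>, they take the three values of the three sums.
\<close>

lemma dual_log_term_eq_soft_max:
  "dual_log_term S N N' q a \<eta>1 \<eta>2 \<nu> =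
     soft_max T q (\<lambda>p. a p * indicator N p + \<eta>1 * indicator N p + \<eta>2 * (- indicator N' p)) \<nu>"
proof -
  define e where "e p = (if p \<in> N' then a p + \<eta>1 - \<eta>2 else if p \<in> N then a p + \<eta>1 else 0)" for p
  have e: "a p * indicator N p + \<eta>1 * indicator N p + \<eta>2 * (- indicator N' p) = e p" for p
    using nested by (auto simp: indicator_def e_def)
  have fin: "finite N" "finite N'"
    using finite_subset[OF nested(2) finite] finite_subset[OF nested(1)] by simp_all
  have "(\<Sum>p\<in>N'. exp ((a p + \<eta>1 - \<eta>2) / \<nu>) * q p) = (\<Sum>p\<in>N'. exp (e p / \<nu>) * q p)"
    "(\<Sum>p\<in>N - N'. exp ((a p + \<eta>1) / \<nu>) * q p) = (\<Sum>p\<in>N - N'. exp (e p / \<nu>) * q p)"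
    "(\<Sum>p\<in>S - N. q p) = (\<Sum>p\<in>S - N. exp (e p / \<nu>) * q p)"
    using nested by (auto simp: e_def intro!: sum.cong)
  then have "(\<Sum>p\<in>N'. exp ((a p + \<eta>1 - \<eta>2) / \<nu>) * q p) + (\<Sum>p\<in>N - N'. exp ((a p + \<eta>1) / \<nu>) * q p)
      + (\<Sum>p\<in>S - N. q p) = (\<Sum>p\<in>S. exp (e p / \<nu>) * q p)"
    using sum.subset_diff[OF nested(1) fin(1), of "\<lambda>p. exp (e p / \<nu>) * q p"]
      sum.subset_diff[OF nested(2) finite, of "\<lambda>p. exp (e p / \<nu>) * q p"] by linarith
  also have "\<dots> = (\<Sum>p\<in>T. exp (e p / \<nu>) * q p)"
    using T finite q_off_T by (intro sum.mono_neutral_right) auto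
  finally show ?thesis
    unfolding dual_log_term_def soft_max_def e T_def e_def[symmetric] by simp
qed

lemma scaled_weak_duality:
  assumes P: "scaled_feasible s P" and dual: "multiplier_feasible \<alpha> \<eta>1 \<eta>2 \<nu>"
  shows "(\<Sum>p\<in>N. wt p * l p * P p) \<le> \<alpha>"
proof -
  obtain Q where Q: "feasible Q" and PQ: "\<And>p. p \<in> S \<Longrightarrow> P p = s * Q p"
    using feasible_normalise[OF P] by blast
  have simp_T: "Q \<in> prob_simplex T" using Q by (simp add: feasible_def)
  have "(\<Sum>p\<in>T. ((l p - \<alpha>) * wt p * indicator N p) * Q p) \<le> 0"
  proof (rule entropy_weak_duality[OF T(1,3) simp_T])
    show "\<kappa> \<le> (\<Sum>p\<in>T. indicator N p * Q p)" "- \<kappa>' \<le> (\<Sum>p\<in>T. - indicator N' p * Q p)"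
      using Q sum_restrict_T[OF simp_T, of N "\<lambda>_. 1"] sum_restrict_T[OF simp_T, of N' "\<lambda>_. 1"] nested
      by (auto simp: feasible_def sum_negf)
    show "rel_entropy T q Q \<le> r" using Q by (simp add: feasible_def)
    show "0 \<le> \<eta>1" "0 \<le> \<eta>2" "0 \<le> \<nu>"
      "soft_max T q (\<lambda>p. (l p - \<alpha>) * wt p * indicator N p + \<eta>1 * indicator N p
        + \<eta>2 * (- indicator N' p)) \<nu> + r * \<nu> - \<eta>1 * \<kappa> - \<eta>2 * (- \<kappa>') \<le> 0"
      using dual by (simp_all add: multiplier_feasible_def dual_log_term_eq_soft_max)
  qed
  then have "(\<Sum>p\<in>N. (l p - \<alpha>) * wt p * Q p) \<le> 0"
    using sum_restrict_T[OF simp_T nested(2)] by simp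
  then have "s * (\<Sum>p\<in>N. (l p - \<alpha>) * wt p * Q p) \<le> 0"
    using P by (simp add: scaled_feasible_def mult_le_0_iff)
  moreover have "s * (\<Sum>p\<in>N. (l p - \<alpha>) * wt p * Q p)
      = (\<Sum>p\<in>N. wt p * l p * P p) - \<alpha> * (\<Sum>p\<in>N. wt p * P p)"
    using nested PQ unfolding sum_distrib_left sum_subtractf[symmetric]
    by (intro sum.cong) (auto simp: algebra_simps)
  ultimately show ?thesis using P by (simp add: scaled_feasible_def)
qed

lemma multipliers_above_budget:
  assumes Q0: "feasible Q0"
    and bound: "\<And>s P. scaled_feasible s P \<Longrightarrow> (\<Sum>p\<in>N. wt p * l p * P p) < \<alpha>"
  obtains \<eta>1 \<eta>2 \<nu> where "multiplier_feasible \<alpha> \<eta>1 \<eta>2 \<nu>"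
proof -
  have feas: "feasible Q \<longleftrightarrow> Q \<in> prob_simplex T \<and> \<kappa> \<le> (\<Sum>p\<in>T. indicator N p * Q p) \<and>
      - \<kappa>' \<le> (\<Sum>p\<in>T. - indicator N' p * Q p) \<and> rel_entropy T q Q \<le> r" for Q
    using sum_restrict_T[of Q N "\<lambda>_. 1"] sum_restrict_T[of Q N' "\<lambda>_. 1"] nested
    by (auto simp: feasible_def sum_negf)
  have neg: "(\<Sum>p\<in>T. ((l p - \<alpha>) * wt p * indicator N p) * Q p) < 0" if Q: "feasible Q" for Q
  proof -
    define W where "W = (\<Sum>p\<in>N. wt p * Q p)"
    have W: "0 < W" "scaled_feasible (1 / W) (\<lambda>p. Q p / W)"
      using feasible_rescale[OF Q] by (auto simp: W_def)
    have "(\<Sum>p\<in>N. wt p * l p * Q p) / W < \<alpha>"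
      using bound[OF W(2)] by (simp add: sum_divide_distrib)
    then have "(\<Sum>p\<in>N. wt p * l p * Q p) - \<alpha> * W < 0" using W by (simp add: field_simps)
    moreover have "(\<Sum>p\<in>N. (l p - \<alpha>) * wt p * Q p) = (\<Sum>p\<in>N. wt p * l p * Q p) - \<alpha> * W"
      unfolding W_def sum_distrib_left sum_subtractf[symmetric]
      by (intro sum.cong) (auto simp: algebra_simps)
    moreover have "Q \<in> prob_simplex T" using Q by (simp add: feasible_def)
    ultimately show ?thesis using sum_restrict_T[OF _ nested(2)] by metis
  qed
  obtain \<eta>1 \<eta>2 \<nu> where "0 \<le> \<eta>1" "0 \<le> \<eta>2" "0 \<le> \<nu>"
    "soft_max T q (\<lambda>p. (l p - \<alpha>) * wt p * indicator N p + \<eta>1 * indicator N p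
        + \<eta>2 * (- indicator N' p)) \<nu> + r * \<nu> - \<eta>1 * \<kappa> - \<eta>2 * (- \<kappa>') < 0"
    using entropy_multipliers[where T = T and q = q and r = r and \<beta> = \<kappa> and \<gamma> = "- \<kappa>'"
        and a = "\<lambda>p. (l p - \<alpha>) * wt p * indicator N p" and b = "indicator N"
        and c = "\<lambda>p. - indicator N' p", OF T(1,3)] Q0 neg
    unfolding feas by blast
  then show thesis
    by (intro that[of \<eta>1 \<eta>2 \<nu>]) (simp add: multiplier_feasible_def dual_log_term_eq_soft_max)
qed

text \<open>
  Multipliers exist for each real \<open>\<alpha>\<close> strictly above the budget, which suffices for the infimum.
\<close>

theorem budget_duality:
  assumes "feasible Q0"
  shows "Sup {ereal (\<Sum>p\<in>N. wt p * l p * P p) | s P. scaled_feasible s P}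
    = Inf {ereal \<alpha> | \<alpha> \<eta>1 \<eta>2 \<nu>. multiplier_feasible \<alpha> \<eta>1 \<eta>2 \<nu>}" (is "?c = ?v")
proof (rule antisym)
  show "?c \<le> ?v"
    by (intro Sup_least Inf_greatest) (auto simp: scaled_weak_duality)
  show "?v \<le> ?c"
  proof (rule dense_ge)
    fix y assume y: "?c < y"
    obtain \<alpha> where \<alpha>: "?c < ereal \<alpha>" "ereal \<alpha> < y"
      using ereal_dense2[OF y] by blast
    have "(\<Sum>p\<in>N. wt p * l p * P p) < \<alpha>" if "scaled_feasible s P" for s P
    proof -
      have "ereal (\<Sum>p\<in>N. wt p * l p * P p) \<le> ?c" using that by (intro Sup_upper) blast
      from order_le_less_trans[OF this \<alpha>(1)] show ?thesis by simp
    qed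
    then obtain \<eta>1 \<eta>2 \<nu> where "multiplier_feasible \<alpha> \<eta>1 \<eta>2 \<nu>"
      using multipliers_above_budget[OF assms] by blast
    then have "?v \<le> ereal \<alpha>" by (intro Inf_lower) blast
    then show "?v \<le> y" using \<alpha>(2) by simp
  qed
qed

end

section \<open>Duality for the partial bootstrap robust budget\<close>

theorem lemma1:
  fixes \<Omega> :: "('dx::finite, 'dy::finite) point set"
    and n k j :: nat
    and d :: "nat \<Rightarrow> ('dx, 'dy) point"
    and dst :: "('dx, 'dy) point \<Rightarrow> real ^ 'dx \<Rightarrow> real"
    and w :: "real ^ 'dx \<Rightarrow> real ^ 'dx \<Rightarrow> real"
    and L :: "real ^ 'dz::finite \<Rightarrow> real ^ 'dy \<Rightarrow> ereal"
    and x0 :: "real ^ 'dx"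
    and r :: real
    and D :: "('dx, 'dy) point pmf"
    and z :: "real ^ 'dz"
  assumes "1 \<le> n"
    and "\<forall>i\<in>{1..n}. d i \<in> \<Omega>"
    and "\<forall>p\<in>\<Omega>. 0 \<le> dst p x0"
    and "\<forall>p\<in>\<Omega>. \<forall>q\<in>\<Omega>. dst p x0 = dst q x0 \<longleftrightarrow> p = q"
    and "\<forall>(x, y)\<in>\<Omega>. 0 < w x x0"
    and "\<forall>u y. 0 \<le> L u y"
    and "\<forall>y. ereal_convex (\<lambda>u. L u y)"
    and "\<forall>u. (\<lambda>y. L u y) \<in> borel_measurable borel"
    and "k \<in> {1..n}"
    and "j \<in> {1..n}"
    and "D \<in> distributions n d"
    and "\<forall>(x, y)\<in>support_points n d. L z y < \<infinity>"
    and "0 \<le> r"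
    and "ereal r > min_radius n d dst x0 k j D"
  shows "partial_budget n d dst w L k r j z D x0 = dual_value n d dst w L k r j z D x0"
proof -
  define S where "S = support_points n d"
  define N where "N = nbhd n d dst x0 j"
  define N' where "N' = nbhd n d dst x0 (j - 1)"
  define wt :: "('dx, 'dy) point \<Rightarrow> real" where "wt p = w (fst p) x0" for p
  define l :: "('dx, 'dy) point \<Rightarrow> real" where "l p = real_of_ereal (L z (snd p))" for p
  define \<kappa> where "\<kappa> = real k / real n"
  define \<kappa>' where "\<kappa>' = (real k - 1) / real n"
  have S: "finite S" "S \<subseteq> \<Omega>" using assms(2) by (auto simp: S_def support_points_def)
  have NS: "N \<subseteq> S" using assms(10) by (auto simp: N_def S_def nbhd_def)
  have "N' \<subseteq> N"
    unfolding N_def N'_def using assms(2,3,10) by (intro nbhd_mono) auto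
  moreover have "0 < wt p" if "p \<in> N" for p
  proof -
    have "p \<in> \<Omega>" using that NS S by blast
    from bspec[OF assms(5) this] show ?thesis by (simp add: wt_def case_prod_beta)
  qed
  ultimately interpret partial_problem S N N' "pmf D" wt l \<kappa> \<kappa>' r
    using S NS assms(1,9) by unfold_locales (auto simp: \<kappa>_def)

  \<comment> \<open>the bound on the radius supplies a feasible point\<close>
  obtain D' where D': "D' \<in> partial_distributions n d dst x0 k j"
    and D'_dist: "bootstrap_dist S (pmf D') (pmf D) < ereal r"
    using assms(14) by (auto simp: min_radius_def INF_less_iff S_def)
  have "set_pmf D' \<subseteq> S"
    using D' by (simp add: partial_distributions_def distributions_def S_def)
  then have D'_simplex: "pmf D' \<in> prob_simplex T"
    using D'_dist S(1) by (intro simplex_of_finite_dist sum_pmf_eq_1) (auto simp: pmf_eq_0_set_pmf)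
  moreover have "\<kappa> \<le> sum (pmf D') N" "sum (pmf D') N' \<le> \<kappa>'"
    using D' by (simp_all add: partial_distributions_def N_def N'_def \<kappa>_def \<kappa>'_def)
  ultimately have "feasible (pmf D')"
    using D'_dist by (simp add: feasible_def bootstrap_dist_simplex)
  note duality = budget_duality[OF this]

  have L_fin: "L z (snd p) = ereal (l p)" if "p \<in> N" for p
  proof -
    have "p \<in> support_points n d" using that NS by (auto simp: S_def)
    from bspec[OF assms(12) this] have "L z (snd p) < \<infinity>" by (simp add: case_prod_beta)
    moreover have "0 \<le> L z (snd p)" using assms(6) by blast
    ultimately show ?thesis by (cases "L z (snd p)") (auto simp: l_def)
  qed
  have objective: "(\<Sum>(x, y)\<in>N. ereal (w x x0) * L z y * ereal (P (x, y)))
      = ereal (\<Sum>p\<in>N. wt p * l p * P p)" for P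
    unfolding sum_ereal[symmetric] case_prod_beta prod.collapse
    by (intro sum.cong) (auto simp: L_fin wt_def)
  have "partial_budget n d dst w L k r j z D x0
      = Sup {ereal (\<Sum>p\<in>N. wt p * l p * P p) | s P. scaled_feasible s P}"
    unfolding partial_budget_def scaled_feasible_def S_def[symmetric] N_def[symmetric]
      N'_def[symmetric] objective
    by (simp add: case_prod_beta wt_def \<kappa>_def \<kappa>'_def)
  moreover have "- \<eta>1 * \<kappa> + \<eta>2 * \<kappa>' = - real k / real n * (\<eta>1 - \<eta>2) - \<eta>2 / real n" for \<eta>1 \<eta>2
    using assms(1) by (simp add: \<kappa>_def \<kappa>'_def field_simps)
  then have "multiplier_feasible \<alpha> \<eta>1 \<eta>2 \<nu> \<longleftrightarrow> 0 \<le> \<eta>1 \<and> 0 \<le> \<eta>2 \<and> 0 \<le> \<nu> \<and>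
      dual_log_term S N N' (pmf D) (\<lambda>(x, y). (real_of_ereal (L z y) - \<alpha>) * w x x0) \<eta>1 \<eta>2 \<nu>
      + r * \<nu> - real k / real n * (\<eta>1 - \<eta>2) - \<eta>2 / real n \<le> 0" for \<alpha> \<eta>1 \<eta>2 \<nu>
    unfolding multiplier_feasible_def l_def wt_def case_prod_beta
    by (smt (verit, best) minus_divide_left mult_minus_left)
  then have "dual_value n d dst w L k r j z D x0
      = Inf {ereal \<alpha> | \<alpha> \<eta>1 \<eta>2 \<nu>. multiplier_feasible \<alpha> \<eta>1 \<eta>2 \<nu>}"
    by (simp add: dual_value_def S_def N_def N'_def)
  ultimately show ?thesis using duality by simp
qed

end
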